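(* There exists an infinite family of (pairwise non-isomorphic) finite simple connected $5$-regular Ricci-flat graphs, each of which is neither isomorphic to the $72$-vertex graph $RF^5_{72}$ nor of Cartesian product type.
   Context: All graphs are finite, simple, connected and unweighted; $d(u,v)$ is the shortest-path distance, $N(x)$ the neighborhood of $x$, and $d_x=|N(x)|$. For a vertex $x$ and $\alpha\in[0,1]$, let $\mu_x^\alpha$ be the probability measure on $V$ with $\mu_x^\alpha(x)=\alpha$, $\mu_x^\alpha(z)=(1-\alpha)/d_x$ for $z\in N(x)$, and $\mu_x^\alpha(z)=0$ otherwise. For probability measures $\mu,\nu$ on $V$, $W_1(\mu,\nu)=\min_\pi\sum_{u,v\in V}d(u,v)\pi(u,v)$, where the minimum is over all $\pi:V\times V\to[0,1]$ with marginals $\mu$ and $\nu$. For an edge $xy$, set $\kappa_\alpha(x,y)=1-W_1(\mu_x^\alpha,\mu_y^\alpha)$, and define the Lin--Lu--Yau curvature by $\kappa(x,y)=\lim_{\alpha\to1^-}\kappa_\alpha(x,y)/(1-\alpha)$ (this limit exists). A graph $G$ is Ricci-flat if $\kappa(x,y)=0$ for every edge $xy\in E(G)$. A graph is symmetric if its automorphism group acts transitively on both its vertex set and its edge set. $RF^5_{72}$ denotes the $5$-regular symmetric Ricci-flat graph constructed by Lei and Bai; it has $72$ vertices, and by their theorem it is the unique $5$-regular symmetric Ricci-flat graph up to isomorphism. The Cartesian product $X\square Y$ has vertex set $V(X)\times V(Y)$, with $(u,x)$ and $(v,y)$ adjacent iff either $u=v$ and $xy\in E(Y)$, or $x=y$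 and $uv\in E(X)$. A graph is of Cartesian product type if it is isomorphic to $X\square Y$ for some finite simple graphs $X,Y$ each having at least two vertices. *)

theory Defs
  imports Complex_Main "Graph_Theory.Graph_Theory"
begin

text \<open>
  A finite simple graph is a \<^locale>\<open>pair_graph\<close>: a finite vertex set with a symmetric, irreflexive
  arc relation, so that an undirected edge \<open>xy\<close> is the pair of arcs \<open>(x, y)\<close> and \<open>(y, x)\<close>.
  Since \<open>connected\<close> also names the topological notion, the graph-theoretic one is always qualified.
\<close>

definition nbhd :: "'a pair_pre_digraph \<Rightarrow> 'a \<Rightarrow> 'a set" where
  "nbhd G x = {z. (x, z) \<in> parcs G}"

definition regular :: "nat \<Rightarrow> 'a pair_pre_digraph \<Rightarrow> bool" where
  "regular k G \<longleftrightarrow> (\<forall>x\<in>pverts G. card (nbhd G x) = k)"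

text \<open>
  The library's shortest-path distance with unit arc costs is extended-real valued; it is finite,
  and hence faithfully represented in \<^typ>\<open>real\<close>, when the graph is connected.
\<close>

definition graph_dist :: "'a pair_pre_digraph \<Rightarrow> 'a \<Rightarrow> 'a \<Rightarrow> real" where
  "graph_dist G u v = real_of_ereal (wf_digraph.\<mu> (with_proj G) (\<lambda>_. 1) u v)"


subsection \<open>Lin--Lu--Yau curvature\<close>

definition nbr_measure :: "'a pair_pre_digraph \<Rightarrow> real \<Rightarrow> 'a \<Rightarrow> 'a \<Rightarrow> real" where
  "nbr_measure G \<alpha> x z =
     (if z = x then \<alpha>
      else if z \<in> nbhd G x then (1 - \<alpha>) / real (card (nbhd G x))
      else 0)"

text \<open>Only the values of a plan on \<open>pverts G \<times> pverts G\<close> matter.\<close>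

definition transport_plans ::
  "'a pair_pre_digraph \<Rightarrow> ('a \<Rightarrow> real) \<Rightarrow> ('a \<Rightarrow> real) \<Rightarrow> ('a \<Rightarrow> 'a \<Rightarrow> real) set" where
  "transport_plans G \<mu> \<nu> =
     {\<pi>. (\<forall>u\<in>pverts G. \<forall>v\<in>pverts G. 0 \<le> \<pi> u v \<and> \<pi> u v \<le> 1) \<and>
         (\<forall>u\<in>pverts G. (\<Sum>v\<in>pverts G. \<pi> u v) = \<mu> u) \<and>
         (\<forall>v\<in>pverts G. (\<Sum>u\<in>pverts G. \<pi> u v) = \<nu> v)}"

text \<open>
  For probability measures the infimum is a minimum: the cost is linear and the plans, restricted
  to \<open>pverts G \<times> pverts G\<close>, form a nonempty compact polytope.
\<close>

definition W1 :: "'a pair_pre_digraph \<Rightarrow> ('a \<Rightarrow> real) \<Rightarrow> ('a \<Rightarrow> real) \<Rightarrow> real" where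
  "W1 G \<mu> \<nu> =
     (INF \<pi>\<in>transport_plans G \<mu> \<nu>. \<Sum>u\<in>pverts G. \<Sum>v\<in>pverts G. graph_dist G u v * \<pi> u v)"

definition kappa_alpha :: "'a pair_pre_digraph \<Rightarrow> real \<Rightarrow> 'a \<Rightarrow> 'a \<Rightarrow> real" where
  "kappa_alpha G \<alpha> x y = 1 - W1 G (nbr_measure G \<alpha> x) (nbr_measure G \<alpha> y)"

definition lly_curvature :: "'a pair_pre_digraph \<Rightarrow> 'a \<Rightarrow> 'a \<Rightarrow> real" where
  "lly_curvature G x y = Lim (at_left 1) (\<lambda>\<alpha>. kappa_alpha G \<alpha> x y / (1 - \<alpha>))"

definition ricci_flat :: "'a pair_pre_digraph \<Rightarrow> bool" where
  "ricci_flat G \<longleftrightarrow> (\<forall>(x, y)\<in>parcs G. lly_curvature G x y = 0)"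


subsection \<open>Symmetric graphs and the 72-vertex graph of Lei and Bai\<close>

definition automorphism ::
  "'a pair_pre_digraph \<Rightarrow> ('a, 'a \<times> 'a, 'a, 'a \<times> 'a) digraph_isomorphism \<Rightarrow> bool" where
  "automorphism G f \<longleftrightarrow>
     pre_digraph.digraph_isomorphism (with_proj G) f \<and> app_iso f (with_proj G) = with_proj G"

text \<open>
  Not to be confused with \<^const>\<open>symmetric\<close>, symmetry of the arc relation. Edge-transitivity
  concerns undirected edges, hence the unordered pairs.
\<close>

definition symmetric_graph :: "'a pair_pre_digraph \<Rightarrow> bool" where
  "symmetric_graph G \<longleftrightarrow>
     (\<forall>u\<in>pverts G. \<forall>v\<in>pverts G. \<exists>f. automorphism G f \<and> iso_verts f u = v) \<and>
     (\<forall>(u, v)\<in>parcs G. \<forall>(x, y)\<in>parcs G. \<exists>f. automorphism G f \<and> iso_verts f ` {u, v} = {x, y})"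

text \<open>
  By the theorem of Lei and Bai these properties determine the graph \<open>RF\<^sup>5\<^sub>7\<^sub>2\<close> up to isomorphism. One
  realization is the coset graph of the alternating group \<open>A\<^sub>6\<close> on the 72 left cosets of \<open>\<langle>c\<rangle>\<close>,
  with \<open>g\<langle>c\<rangle>\<close> adjacent to \<open>g c\<^sup>i t\<langle>c\<rangle>\<close>, where \<open>c\<close> has order 5, \<open>t\<close> has order 2, \<open>c t\<close> has order 4,
  and \<open>c\<close> and \<open>t\<close> generate \<open>A\<^sub>6\<close>.
\<close>

definition is_RF72 :: "'a pair_pre_digraph \<Rightarrow> bool" where
  "is_RF72 R \<longleftrightarrow>
     pair_graph R \<and> Digraph_Component.connected (with_proj R) \<and>
     regular 5 R \<and> symmetric_graph R \<and> ricci_flat R \<and> card (pverts R) = 72"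


subsection \<open>Cartesian products\<close>

definition cartesian_product ::
  "'a pair_pre_digraph \<Rightarrow> 'b pair_pre_digraph \<Rightarrow> ('a \<times> 'b) pair_pre_digraph" where
  "cartesian_product X Y =
     \<lparr>pverts = pverts X \<times> pverts Y,
      parcs = {((u, x), (v, y)) | u x v y.
                 u = v \<and> u \<in> pverts X \<and> (x, y) \<in> parcs Y \<or>
                 x = y \<and> x \<in> pverts Y \<and> (u, v) \<in> parcs X}\<rparr>"

text \<open>Up to isomorphism every finite graph has its vertices in \<^typ>\<open>nat\<close>.\<close>

definition cartesian_product_type :: "'a pair_pre_digraph \<Rightarrow> bool" where
  "cartesian_product_type G \<longleftrightarrow>
     (\<exists>(X :: nat pair_pre_digraph) (Y :: nat pair_pre_digraph).
        pair_graph X \<and> pair_graph Y \<and> 2 \<le> card (pverts X) \<and> 2 \<le> card (pverts Y) \<and>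
        digraph_iso (with_proj G) (with_proj (cartesian_product X Y)))"

end

theory Submission
  imports Defs
begin

text \<open>
  The graphs are Petersen bundles over cycles of length \<open>n \<ge> 7\<close>, twisted by a rotation of order 5.
  Locally they look like the product of a cycle and the Petersen graph, which is Ricci-flat. Globally
  they are not products: following the base direction around the cycle ends at a different vertex of
  the same fibre, whereas in a product a walk that fixes one coordinate cannot join two vertices that
  agree in the other. They have \<open>10 n \<noteq> 72\<close> vertices.

  Flatness of an arc is certified by a matching of the remaining neighbours as an upper bound for the
  transport distance, and a 1-Lipschitz function of the same value as a lower bound.
\<close>

subsection \<open>Curvature certificates\<close>

text \<open>The twist must go unnoticed by every transport problem and still destroy the product
  structure. Curvature looks only at the surroundings of an arc, but its lower bound asks for a
  function that is 1-Lipschitz on the whole graph, rotation included, which is why the base must be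
  long. Since all degrees are 5, the certificate needs the four remaining neighbours at either end
  to be matched at total cost 6. A base arc spends this as 3 + 1 + 1 + 1, along the cycle and in
  parallel to the arc; a fibre arc as 1 + 1 + 2 + 2, with the 1s over the two adjacent base points
  and the 2s inside the Petersen graph, whose girth is 5. The rotation has order 5 so that its
  powers act transitively on the positions of a pentagon.\<close>

context pair_graph
begin

lemma symmetric_connected_awalk:
  assumes "Digraph_Component.connected (with_proj G)" "u \<in> pverts G" "v \<in> pverts G"
  obtains p where "awalk u p v"
proof -
  have "strongly_connected (with_proj G)"
    using assms(1) pair_sym_arcs by (intro symmetric_connected_imp_strongly_connected) auto
  then have "u \<rightarrow>\<^sup>*\<^bsub>with_proj G\<^esub> v"
    using assms by (auto simp: strongly_connected_def)
  then show thesis using that by (auto simp: reachable_awalk)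
qed

lemma lipschitz_awalk:
  fixes F :: "'a \<Rightarrow> real"
  assumes lip: "\<And>u v. (u, v) \<in> parcs G \<Longrightarrow> F u - F v \<le> 1" and "awalk u p v"
  shows "F u - F v \<le> awalk_cost (\<lambda>_. 1) p"
  using assms(2)
proof (induction p arbitrary: u)
  case (Cons e p)
  then have "e \<in> parcs G" "u = fst e" "awalk (snd e) p v" by (auto simp: awalk_Cons_iff)
  then show ?case using lip[of "fst e" "snd e"] Cons.IH[of "snd e"] by simp
qed (auto simp: awalk_Nil_iff)

lemma ereal_lipschitz_le_\<mu>:
  fixes F :: "'a \<Rightarrow> real"
  assumes "\<And>u v. (u, v) \<in> parcs G \<Longrightarrow> F u - F v \<le> 1"
  shows "ereal (F u - F v) \<le> \<mu> (\<lambda>_. 1) u v"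
  unfolding \<mu>_def using lipschitz_awalk[OF assms] by (intro INF_greatest) auto

lemma awalk_cost_length: "awalk_cost (\<lambda>_. 1) p = real (length p)"
  by (induction p) auto

text \<open>A walk bounds the infimum from above and the constant function 0 bounds it from below,
  so the value is finite and \<open>real_of_ereal\<close> loses nothing.\<close>

lemma ereal_graph_dist:
  assumes "awalk u p v"
  shows "ereal (graph_dist G u v) = \<mu> (\<lambda>_. 1) u v"
proof -
  have "0 \<le> \<mu> (\<lambda>_. 1) u v"
    using ereal_lipschitz_le_\<mu>[of "\<lambda>_. 0"] by (simp add: zero_ereal_def)
  moreover have "\<mu> (\<lambda>_. 1) u v \<le> ereal (length p)"
    using min_cost_le_walk_cost[OF assms, of "\<lambda>_. 1"] by (simp add: awalk_cost_length)
  ultimately have "\<bar>\<mu> (\<lambda>_. 1) u v\<bar> \<noteq> \<infinity>" by auto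
  then show ?thesis unfolding graph_dist_def by (simp add: ereal_real)
qed

lemma lipschitz_le_graph_dist:
  fixes F :: "'a \<Rightarrow> real"
  assumes "\<And>u v. (u, v) \<in> parcs G \<Longrightarrow> F u - F v \<le> 1" and "awalk u p v"
  shows "F u - F v \<le> graph_dist G u v"
  using ereal_lipschitz_le_\<mu>[of F u v, OF assms(1)] ereal_graph_dist[OF assms(2)]
  by (metis ereal_less_eq(3))

lemma graph_dist_le_length:
  assumes "awalk u p v"
  shows "graph_dist G u v \<le> length p"
  using min_cost_le_walk_cost[OF assms, of "\<lambda>_. 1"] ereal_graph_dist[OF assms]
  by (metis awalk_cost_length ereal_less_eq(3))

lemma graph_dist_commute: "graph_dist G u v = graph_dist G v u"
proof -
  have len: "length (rev_path q) = length q" for q :: "('a \<times> 'a) list"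
    by (induction q) auto
  have le: "\<mu> (\<lambda>_. 1) u v \<le> \<mu> (\<lambda>_. 1) v u" for u v
    unfolding \<mu>_def
  proof (rule INF_greatest)
    fix p assume "p \<in> {p. awalk v p u}"
    then have "awalk u (rev_path p) v" by simp
    then show "(INF p\<in>{p. awalk u p v}. ereal (awalk_cost (\<lambda>_. 1) p)) \<le> ereal (awalk_cost (\<lambda>_. 1) p)"
      by (intro INF_lower2[where i = "rev_path p"]) (auto simp: awalk_cost_length len)
  qed
  show ?thesis unfolding graph_dist_def using le[of u v] le[of v u] by simp
qed

lemma nbhd_subset: "nbhd G x \<subseteq> pverts G"
  by (auto simp: nbhd_def dest: in_arcsD2)

lemma sum_nbr_measure:
  fixes F :: "'a \<Rightarrow> real"
  assumes "x \<in> pverts G"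
  shows "(\<Sum>u\<in>pverts G. F u * nbr_measure G \<alpha> x u) =
    \<alpha> * F x + (1 - \<alpha>) / card (nbhd G x) * (\<Sum>u\<in>nbhd G x. F u)"
proof -
  have "x \<notin> nbhd G x" using no_loops' by (auto simp: nbhd_def)
  then have "F u * nbr_measure G \<alpha> x u =
      (if u = x then \<alpha> * F x else 0) + (if u \<in> nbhd G x then (1 - \<alpha>) / card (nbhd G x) * F u else 0)" for u
    by (auto simp: nbr_measure_def)
  then show ?thesis using assms pair_finite_verts nbhd_subset[of x]
    by (simp add: sum.distrib sum.If_cases sum_distrib_left Int_absorb1)
qed

text \<open>By the two marginal conditions the left side is the sum of \<open>F u - F v\<close>
  weighted by the plan, and each such difference is at most the distance.\<close>

lemma kantorovich_weak_duality:
  fixes F :: "'a \<Rightarrow> real"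
  assumes "Digraph_Component.connected (with_proj G)"
    and "\<And>u v. (u, v) \<in> parcs G \<Longrightarrow> F u - F v \<le> 1"
    and pi: "\<pi> \<in> transport_plans G \<mu>' \<nu>"
  shows "(\<Sum>u\<in>pverts G. F u * \<mu>' u) - (\<Sum>v\<in>pverts G. F v * \<nu> v)
    \<le> (\<Sum>u\<in>pverts G. \<Sum>v\<in>pverts G. graph_dist G u v * \<pi> u v)"
proof -
  have "(\<Sum>u\<in>pverts G. F u * \<mu>' u) - (\<Sum>v\<in>pverts G. F v * \<nu> v)
      = (\<Sum>u\<in>pverts G. \<Sum>v\<in>pverts G. F u * \<pi> u v) - (\<Sum>v\<in>pverts G. \<Sum>u\<in>pverts G. F v * \<pi> u v)"
    using pi by (simp add: transport_plans_def flip: sum_distrib_left)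
  also have "\<dots> = (\<Sum>u\<in>pverts G. \<Sum>v\<in>pverts G. (F u - F v) * \<pi> u v)"
    by (subst (2) sum.swap) (simp add: left_diff_distrib sum_subtractf)
  also have "\<dots> \<le> (\<Sum>u\<in>pverts G. \<Sum>v\<in>pverts G. graph_dist G u v * \<pi> u v)"
  proof (intro sum_mono mult_right_mono)
    fix u v assume uv: "u \<in> pverts G" "v \<in> pverts G"
    then obtain p where "awalk u p v" using symmetric_connected_awalk assms(1) by blast
    then show "F u - F v \<le> graph_dist G u v" using lipschitz_le_graph_dist assms(2) by blast
    show "0 \<le> \<pi> u v" using pi uv by (auto simp: transport_plans_def)
  qed
  finally show ?thesis .
qed

text \<open>Weak duality serves twice: it gives the lower bound, and it shows that the costs are
  bounded below, without which the real infimum says nothing about its members.\<close>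

lemma W1_eqI:
  fixes F :: "'a \<Rightarrow> real"
  assumes "Digraph_Component.connected (with_proj G)"
    and "\<And>u v. (u, v) \<in> parcs G \<Longrightarrow> F u - F v \<le> 1"
    and pi: "\<pi> \<in> transport_plans G \<mu>' \<nu>"
    and "(\<Sum>u\<in>pverts G. \<Sum>v\<in>pverts G. graph_dist G u v * \<pi> u v) \<le> c"
    and "(\<Sum>u\<in>pverts G. F u * \<mu>' u) - (\<Sum>v\<in>pverts G. F v * \<nu> v) = c"
  shows "W1 G \<mu>' \<nu> = c"
proof -
  note ge = kantorovich_weak_duality[where F = F, OF assms(1,2), of _ \<mu>' \<nu>, unfolded assms(5)]
  show ?thesis unfolding W1_def
  proof (rule antisym)
    have "bdd_below ((\<lambda>\<pi>. \<Sum>u\<in>pverts G. \<Sum>v\<in>pverts G. graph_dist G u v * \<pi> u v) ` transport_plans G \<mu>' \<nu>)"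
      using ge by (intro bdd_belowI2[where m = c]) auto
    then show "(INF \<pi>\<in>transport_plans G \<mu>' \<nu>. \<Sum>u\<in>pverts G. \<Sum>v\<in>pverts G. graph_dist G u v * \<pi> u v) \<le> c"
      using pi assms(4) by (meson cINF_lower order_trans)
    show "c \<le> (INF \<pi>\<in>transport_plans G \<mu>' \<nu>. \<Sum>u\<in>pverts G. \<Sum>v\<in>pverts G. graph_dist G u v * \<pi> u v)"
      using pi ge by (intro cINF_greatest) auto
  qed
qed

text \<open>
  The plan moves the idle mass from \<open>x\<close> to \<open>y\<close>, except for the share that either end
  keeps as the mass of a neighbour of the other, and moves \<open>zs ! i\<close> to \<open>ws ! i\<close>. Its cost and the
  value of \<open>F\<close> agree exactly when the matching costs \<open>length zs + 2\<close>.
\<close>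

lemma W1_nbr_measure_eq_1:
  fixes F :: "'a \<Rightarrow> real"
  assumes conn: "Digraph_Component.connected (with_proj G)"
    and xy: "(x, y) \<in> parcs G"
    and Nx: "nbhd G x = set (y # zs)" "distinct (y # zs)"
    and Ny: "nbhd G y = set (x # ws)" "distinct (x # ws)"
    and len: "length ws = length zs"
    and cost: "sum_list (map2 (graph_dist G) zs ws) \<le> length zs + 2"
    and lip: "\<And>u v. (u, v) \<in> parcs G \<Longrightarrow> F u - F v \<le> 1"
    and Fxy: "F x - F y = 1"
    and Fsum: "sum_list (map F zs) - sum_list (map F ws) = length zs + 2"
    and \<alpha>: "1 / (length zs + 2) \<le> \<alpha>" "\<alpha> \<le> 1"
  shows "W1 G (nbr_measure G \<alpha> x) (nbr_measure G \<alpha> y) = 1"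
proof (rule W1_eqI[OF conn lip])
  define k where "k = length zs"
  \<comment> \<open>The mass of a single neighbour in either measure, as both ends have degree
    \<open>k + 1\<close>.\<close>
  define \<beta> where "\<beta> = (1 - \<alpha>) / (k + 1)"
  have \<alpha>\<beta>: "\<alpha> + \<beta> * (k + 1) = 1" by (simp add: \<beta>_def field_simps)
  have \<beta>0: "0 \<le> \<beta>" using \<alpha> by (simp add: \<beta>_def)
  \<comment> \<open>Equivalent to the lower bound on \<alpha>; it keeps the coefficient
    \<open>\<alpha> - \<beta>\<close> of the plan nonnegative.\<close>
  have \<beta>\<alpha>: "\<beta> \<le> \<alpha>" using \<alpha> by (simp add: \<beta>_def k_def field_simps)
  have xyV: "x \<in> pverts G" "y \<in> pverts G" using xy wellformed' by blast+
  have xney: "x \<noteq> y" using xy no_loops' by blast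
  have cx: "card (nbhd G x) = k + 1" unfolding Nx(1) distinct_card[OF Nx(2)] k_def by simp
  have cy: "card (nbhd G y) = k + 1" unfolding Ny(1) distinct_card[OF Ny(2)] k_def by (simp add: len)
  have c\<beta>x: "(1 - \<alpha>) / real (card (nbhd G x)) = \<beta>" and c\<beta>y: "(1 - \<alpha>) / real (card (nbhd G y)) = \<beta>"
    by (simp_all add: cx cy \<beta>_def)
  have zV: "zs ! i \<in> pverts G" if "i < k" for i
    using nbhd_subset[of x] Nx(1) that by (auto simp: k_def)
  have wV: "ws ! i \<in> pverts G" if "i < k" for i
    using nbhd_subset[of y] Ny(1) that len by (auto simp: k_def)
  have count: "(\<Sum>i<k. of_bool (u = l ! i)) = (of_bool (u \<in> set l) :: real)"
    if l: "distinct l" "length l = k" for l :: "'a list" and u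
  proof (cases "u \<in> set l")
    case True
    then obtain j where j: "j < k" "u = l ! j" using l by (metis in_set_conv_nth)
    then have "u = l ! i \<longleftrightarrow> i = j" if "i < k" for i
      using that l by (auto simp: nth_eq_iff_index_eq)
    then have "(\<Sum>i<k. of_bool (u = l ! i)) = (\<Sum>i<k. of_bool (i = j) :: real)" by (intro sum.cong) auto
    also have "\<dots> = 1" using j by (simp add: of_bool_def)
    finally show ?thesis using True by simp
  next
    case False
    then have "u \<noteq> l ! i" if "i < k" for i using that l by auto
    then show ?thesis using False by simp
  qed
  have xz: "x \<notin> set zs" and yw: "y \<notin> set ws"
    using Nx(1) Ny(1) no_loops' by (auto simp: nbhd_def)
  \<comment> \<open>The idle mass is split as \<open>(\<alpha> - \<beta>) + \<beta>\<close>, so that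
    the summands correspond one by one to those of the plan.\<close>
  have mx: "nbr_measure G \<alpha> x u = (\<alpha> - \<beta>) * of_bool (u = x) + \<beta> * of_bool (u = x) + \<beta> * of_bool (u = y)
      + \<beta> * (\<Sum>i<k. of_bool (u = zs ! i))" for u
  proof -
    have "(\<Sum>i<k. of_bool (u = zs ! i)) = (of_bool (u \<in> set zs) :: real)"
      using Nx(2) len by (intro count) (auto simp: k_def)
    moreover have "u \<in> nbhd G x \<longleftrightarrow> u = y \<or> u \<in> set zs" using Nx(1) by simp
    moreover have "y \<notin> set zs" using Nx(2) by simp
    ultimately show ?thesis using xz xney
      by (cases "u = x"; cases "u = y"; cases "u \<in> set zs") (simp_all add: nbr_measure_def c\<beta>x)
  qed
  have my: "nbr_measure G \<alpha> y u = (\<alpha> - \<beta>) * of_bool (u = y) + \<beta> * of_bool (u = x) + \<beta> * of_bool (u = y)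
      + \<beta> * (\<Sum>i<k. of_bool (u = ws ! i))" for u
  proof -
    have "(\<Sum>i<k. of_bool (u = ws ! i)) = (of_bool (u \<in> set ws) :: real)"
      using Ny(2) len by (intro count) (auto simp: k_def)
    moreover have "u \<in> nbhd G y \<longleftrightarrow> u = x \<or> u \<in> set ws" using Ny(1) by simp
    moreover have "x \<notin> set ws" using Ny(2) by simp
    ultimately show ?thesis using yw xney
      by (cases "u = x"; cases "u = y"; cases "u \<in> set ws") (simp_all add: nbr_measure_def c\<beta>y)
  qed
  define \<pi> where "\<pi> u v = (\<alpha> - \<beta>) * (of_bool (u = x) * of_bool (v = y)) + \<beta> * (of_bool (u = x) * of_bool (v = x))
    + \<beta> * (of_bool (u = y) * of_bool (v = y)) + \<beta> * (\<Sum>i<k. of_bool (u = zs ! i) * of_bool (v = ws ! i))" for u v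
  have pick: "(\<Sum>v\<in>pverts G. g v * of_bool (v = w)) = g w" if "w \<in> pverts G" for g :: "'a \<Rightarrow> real" and w
    using that pair_finite_verts by (simp add: of_bool_def if_distrib[of "(*) _"] cong: if_cong)
  have sumi: "(\<Sum>v\<in>pverts G. g v * (\<Sum>i<k. h i * of_bool (v = l ! i))) = (\<Sum>i<k. g (l ! i) * h i)"
    if "\<And>i. i < k \<Longrightarrow> l ! i \<in> pverts G" for g h :: "_ \<Rightarrow> real" and l :: "'a list"
  proof -
    have "(\<Sum>v\<in>pverts G. g v * (\<Sum>i<k. h i * of_bool (v = l ! i)))
        = (\<Sum>i<k. \<Sum>v\<in>pverts G. (g v * h i) * of_bool (v = l ! i))"
      by (subst sum.swap) (simp only: sum_distrib_left mult.assoc)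
    also have "\<dots> = (\<Sum>i<k. g (l ! i) * h i)" using that by (intro sum.cong) (auto simp: pick)
    finally show ?thesis .
  qed
  have expand: "h * (a * (s * p) + b * (s * q) + b * (t * p) + b * S)
      = a * s * h * p + b * s * h * q + b * t * h * p + b * (h * S)" for a b h p q s t S :: real
    by (simp add: algebra_simps)
  have expand': "a * (s * p) + b * (s * q) + b * (t * p) + b * S = a * p * s + b * q * s + b * p * t + b * S"
    for a b p q s t S :: real
    by (simp add: algebra_simps)
  \<comment> \<open>The explicit factor 1 lets \<open>sumi\<close> apply with a constant
    \<open>g\<close>.\<close>
  have swap: "(\<Sum>i<k. of_bool (u = zs ! i) * of_bool (v = ws ! i)) =
      (1 * (\<Sum>i<k. of_bool (v = ws ! i) * of_bool (u = zs ! i)) :: real)" for u v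
    by (simp add: mult.commute)
  \<comment> \<open>The weight \<open>g\<close> makes one computation serve both the first marginal,
    with \<open>g = 1\<close>, and the cost, with \<open>g\<close> the distance from
    \<open>u\<close>.\<close>
  have row: "(\<Sum>v\<in>pverts G. g v * \<pi> u v) = (\<alpha> - \<beta>) * (g y * of_bool (u = x)) + \<beta> * (g x * of_bool (u = x))
      + \<beta> * (g y * of_bool (u = y)) + \<beta> * (\<Sum>i<k. g (ws ! i) * of_bool (u = zs ! i))" for g :: "'a \<Rightarrow> real" and u
  proof -
    have "(\<Sum>v\<in>pverts G. g v * \<pi> u v) =
        (\<Sum>v\<in>pverts G. (\<alpha> - \<beta>) * of_bool (u = x) * g v * of_bool (v = y))
        + (\<Sum>v\<in>pverts G. \<beta> * of_bool (u = x) * g v * of_bool (v = x))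
        + (\<Sum>v\<in>pverts G. \<beta> * of_bool (u = y) * g v * of_bool (v = y))
        + \<beta> * (\<Sum>v\<in>pverts G. g v * (\<Sum>i<k. of_bool (u = zs ! i) * of_bool (v = ws ! i)))"
      unfolding \<pi>_def expand sum.distrib by (simp only: flip: sum_distrib_left)
    then show ?thesis using xyV wV by (simp only: pick sumi) (simp add: mult_ac)
  qed
  have row1: "(\<Sum>v\<in>pverts G. \<pi> u v) = nbr_measure G \<alpha> x u" for u
    using row[of "\<lambda>_. 1" u] by (simp add: mx)
  have col1: "(\<Sum>u\<in>pverts G. \<pi> u v) = nbr_measure G \<alpha> y v" for v
  proof -
    have "(\<Sum>u\<in>pverts G. \<pi> u v) =
        (\<Sum>u\<in>pverts G. (\<alpha> - \<beta>) * of_bool (v = y) * of_bool (u = x))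
        + (\<Sum>u\<in>pverts G. \<beta> * of_bool (v = x) * of_bool (u = x))
        + (\<Sum>u\<in>pverts G. \<beta> * of_bool (v = y) * of_bool (u = y))
        + \<beta> * (\<Sum>u\<in>pverts G. 1 * (\<Sum>i<k. of_bool (v = ws ! i) * of_bool (u = zs ! i)))"
      unfolding \<pi>_def swap expand' sum.distrib by (simp only: flip: sum_distrib_left)
    then show ?thesis using xyV zV by (simp only: pick sumi my) simp
  qed
  have \<pi>0: "0 \<le> \<pi> u v" for u v
    unfolding \<pi>_def using \<beta>0 \<beta>\<alpha> by (intro add_nonneg_nonneg mult_nonneg_nonneg sum_nonneg) auto
  have "\<beta> \<le> 1" using \<beta>\<alpha> \<alpha> by simp
  then have m1: "nbr_measure G \<alpha> x u \<le> 1" for u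
    using \<alpha> by (auto simp: nbr_measure_def cx \<beta>_def)
  have "\<pi> u v \<le> 1" if "v \<in> pverts G" for u v
    using member_le_sum[of v "pverts G" "\<pi> u"] that \<pi>0 pair_finite_verts row1[of u] m1[of u] by auto
  then show "\<pi> \<in> transport_plans G (nbr_measure G \<alpha> x) (nbr_measure G \<alpha> y)"
    by (auto simp: transport_plans_def row1 col1 \<pi>0)
  have d0: "graph_dist G u u \<le> 0" if "u \<in> pverts G" for u
    using graph_dist_le_length[of u "[]" u] that by (simp add: awalk_Nil_iff)
  have d1: "graph_dist G x y \<le> 1"
    using graph_dist_le_length[of x "[(x, y)]" y] xy xyV by (simp add: awalk_simps)
  have "(\<Sum>u\<in>pverts G. \<Sum>v\<in>pverts G. graph_dist G u v * \<pi> u v)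
      = (\<Sum>u\<in>pverts G. (\<alpha> - \<beta>) * graph_dist G u y * of_bool (u = x))
        + (\<Sum>u\<in>pverts G. \<beta> * graph_dist G u x * of_bool (u = x))
        + (\<Sum>u\<in>pverts G. \<beta> * graph_dist G u y * of_bool (u = y))
        + \<beta> * (\<Sum>i<k. \<Sum>u\<in>pverts G. graph_dist G u (ws ! i) * of_bool (u = zs ! i))"
    by (simp only: row mult.assoc sum.distrib sum.swap[of _ "{..<k}" "pverts G"] flip: sum_distrib_left)
  also have "\<dots> = (\<alpha> - \<beta>) * graph_dist G x y + \<beta> * graph_dist G x x + \<beta> * graph_dist G y y
      + \<beta> * (\<Sum>i<k. graph_dist G (zs ! i) (ws ! i))"
    using xyV zV by (simp add: pick)
  also have "(\<Sum>i<k. graph_dist G (zs ! i) (ws ! i)) = sum_list (map2 (graph_dist G) zs ws)"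
    by (simp add: sum_list_sum_nth len k_def atLeast0LessThan)
  also have "(\<alpha> - \<beta>) * graph_dist G x y + \<beta> * graph_dist G x x + \<beta> * graph_dist G y y + \<beta> * \<dots>
      \<le> (\<alpha> - \<beta>) * 1 + \<beta> * 0 + \<beta> * 0 + \<beta> * (k + 2)"
    using \<beta>0 \<beta>\<alpha> d0 d1 xyV cost by (intro add_mono mult_left_mono) (auto simp: k_def)
  \<comment> \<open>\<open>(\<alpha> - \<beta>) + \<beta> * (k + 2)\<close> is
    \<open>\<alpha> + \<beta> * (k + 1)\<close>, the total mass; this is where the budget
    \<open>length zs + 2\<close> of the matching comes from.\<close>
  also have "\<dots> = 1" using \<alpha>\<beta> by (simp add: algebra_simps)
  finally show "(\<Sum>u\<in>pverts G. \<Sum>v\<in>pverts G. graph_dist G u v * \<pi> u v) \<le> 1" .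
  have sx: "(\<Sum>u\<in>nbhd G x. F u) = F y + sum_list (map F zs)"
    using Nx by (simp add: sum_list_distinct_conv_sum_set)
  have sy: "(\<Sum>u\<in>nbhd G y. F u) = F x + sum_list (map F ws)"
    using Ny by (simp add: sum_list_distinct_conv_sum_set)
  have \<beta>': "(1 - \<alpha>) / real (k + 1) = \<beta>" by (simp add: \<beta>_def)
  have "\<alpha> * F x + \<beta> * (F y + sum_list (map F zs)) - (\<alpha> * F y + \<beta> * (F x + sum_list (map F ws)))
      = \<alpha> * (F x - F y) + \<beta> * ((sum_list (map F zs) - sum_list (map F ws)) - (F x - F y))"
    by (simp add: algebra_simps)
  also have "\<dots> = 1" unfolding Fxy Fsum using \<alpha>\<beta> by (simp add: k_def algebra_simps)
  finally show "(\<Sum>u\<in>pverts G. F u * nbr_measure G \<alpha> x u) - (\<Sum>v\<in>pverts G. F v * nbr_measure G \<alpha> y v) = 1"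
    by (simp only: sum_nbr_measure xyV cx cy sx sy \<beta>')
qed auto

lemma lly_curvature_eq_0:
  fixes F :: "'a \<Rightarrow> real"
  assumes "Digraph_Component.connected (with_proj G)"
    and "(x, y) \<in> parcs G"
    and "nbhd G x = set (y # zs)" "distinct (y # zs)"
    and "nbhd G y = set (x # ws)" "distinct (x # ws)"
    and "length ws = length zs"
    and "sum_list (map2 (graph_dist G) zs ws) \<le> length zs + 2"
    and "\<And>u v. (u, v) \<in> parcs G \<Longrightarrow> F u - F v \<le> 1"
    and "F x - F y = 1"
    and "sum_list (map F zs) - sum_list (map F ws) = length zs + 2"
  shows "lly_curvature G x y = 0"
proof -
  have "\<forall>\<^sub>F \<alpha> in at_left (1::real). 1 / (length zs + 2) < \<alpha>"
    by (intro eventually_at_leftI[where a = "1 / (length zs + 2)"]) (auto simp: field_simps)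
  moreover have "\<forall>\<^sub>F \<alpha> in at_left (1::real). \<alpha> < 1"
    by (simp add: eventually_at_filter)
  ultimately have "\<forall>\<^sub>F \<alpha> in at_left 1. kappa_alpha G \<alpha> x y / (1 - \<alpha>) = 0"
    by eventually_elim (use W1_nbr_measure_eq_1[OF assms] in \<open>simp add: kappa_alpha_def\<close>)
  then have "((\<lambda>\<alpha>. kappa_alpha G \<alpha> x y / (1 - \<alpha>)) \<longlongrightarrow> 0) (at_left 1)"
    by (rule tendsto_eventually)
  then show ?thesis unfolding lly_curvature_def
    by (intro tendsto_Lim) auto
qed

text \<open>A certificate is reversed by exchanging the two lists and negating \<open>F\<close>, so
  one per undirected edge suffices.\<close>

lemma lly_curvature_eq_0_both:
  fixes F :: "'a \<Rightarrow> real"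
  assumes conn: "Digraph_Component.connected (with_proj G)"
    and xy: "(x, y) \<in> parcs G"
    and N: "nbhd G x = set (y # zs)" "distinct (y # zs)" "nbhd G y = set (x # ws)" "distinct (x # ws)"
    and len: "length ws = length zs"
    and cost: "sum_list (map2 (graph_dist G) zs ws) \<le> length zs + 2"
    and lip: "\<And>u v. (u, v) \<in> parcs G \<Longrightarrow> F u - F v \<le> 1"
    and F: "F x - F y = 1" "sum_list (map F zs) - sum_list (map F ws) = length zs + 2"
  shows "lly_curvature G x y = 0 \<and> lly_curvature G y x = 0"
proof
  show "lly_curvature G x y = 0" by (rule lly_curvature_eq_0[OF assms])
  have comm: "map2 (graph_dist G) ws zs = map2 (graph_dist G) zs ws"
    using len by (intro nth_equalityI) (auto simp: graph_dist_commute)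
  have neg: "sum_list (map (\<lambda>v. - F v) l) = - sum_list (map F l)" for l
    by (induction l) auto
  show "lly_curvature G y x = 0"
    by (rule lly_curvature_eq_0[OF conn arcs_symmetric[OF xy] N(3,4,1,2), where F = "\<lambda>v. - F v"])
      (use len cost F lip[OF arcs_symmetric] in \<open>auto simp: comm neg\<close>)
qed

end

subsection \<open>Isomorphisms and Cartesian products\<close>

text \<open>An isomorphism carries its own maps for arcs, tails and heads. Between pair digraphs
  tail and head are the projections, which forces the arc map to be induced by the vertex
  map.\<close>

lemma digraph_iso_with_projE:
  assumes "digraph_iso (with_proj G) (with_proj H)"
  obtains h where "bij_betw h (pverts G) (pverts H)"
    "\<And>u v. u \<in> pverts G \<Longrightarrow> v \<in> pverts G \<Longrightarrow> (h u, h v) \<in> parcs H \<longleftrightarrow> (u, v) \<in> parcs G"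
proof -
  obtain f where f: "pre_digraph.digraph_isomorphism (with_proj G) f" "with_proj H = app_iso f (with_proj G)"
    using assms by (auto simp: digraph_iso_def)
  have V: "pverts H = iso_verts f ` pverts G" and A: "parcs H = iso_arcs f ` parcs G"
    using f(2) by (metis verts_app_iso arcs_app_iso with_proj_simps(1,2))+
  have ht: "iso_tail f = fst" "iso_head f = snd"
    using f(2) by (metis tail_app_iso head_app_iso with_proj_simps(4,5))+
  have inj: "inj_on (iso_verts f) (pverts G)" and wf: "wf_digraph (with_proj G)"
    using f(1) by (auto simp: pre_digraph.digraph_isomorphism_def)
  have arc: "iso_arcs f e = (iso_verts f (fst e), iso_verts f (snd e))" if "e \<in> parcs G" for e
    using f(1) that by (auto simp: pre_digraph.digraph_isomorphism_def ht prod_eq_iff)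
  have in_verts: "fst e \<in> pverts G" "snd e \<in> pverts G" if "e \<in> parcs G" for e
    using wf_digraph.wellformed[OF wf] that by auto
  show thesis
  proof (rule that)
    show "bij_betw (iso_verts f) (pverts G) (pverts H)" using inj V by (simp add: bij_betw_def)
    fix u v assume uv: "u \<in> pverts G" "v \<in> pverts G"
    show "(iso_verts f u, iso_verts f v) \<in> parcs H \<longleftrightarrow> (u, v) \<in> parcs G"
    proof
      assume "(iso_verts f u, iso_verts f v) \<in> parcs H"
      then obtain e where e: "e \<in> parcs G" "iso_verts f u = iso_verts f (fst e)" "iso_verts f v = iso_verts f (snd e)"
        unfolding A using arc by auto
      then have "u = fst e" "v = snd e" using inj_onD[OF inj] uv in_verts[OF e(1)] by blast+
      then show "(u, v) \<in> parcs G" using e(1) by simp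
    next
      assume "(u, v) \<in> parcs G"
      then show "(iso_verts f u, iso_verts f v) \<in> parcs H" unfolding A using arc[of "(u, v)"] by force
    qed
  qed
qed

lemma card_pverts_digraph_iso:
  assumes "digraph_iso (with_proj G) (with_proj H)"
  shows "card (pverts G) = card (pverts H)"
  using digraph_iso_with_projE[OF assms] by (metis bij_betw_same_card)

text \<open>\<open>p\<close> and \<open>q\<close> are the coordinates of an isomorphism onto a product.\<close>

lemma (in pair_graph) cartesian_product_typeE:
  assumes "cartesian_product_type G"
  obtains p q :: "'a \<Rightarrow> nat" where
    "\<And>u v. (u, v) \<in> parcs G \<Longrightarrow> p u = p v \<or> q u = q v"
    "\<And>u v w. (u, v) \<in> parcs G \<Longrightarrow> (u, w) \<in> parcs G \<Longrightarrow> p u = p v \<Longrightarrow> q u = q w \<Longrightarrow>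
       \<exists>t. t \<noteq> u \<and> (v, t) \<in> parcs G \<and> (w, t) \<in> parcs G"
    "\<exists>u\<in>pverts G. \<exists>v\<in>pverts G. p u \<noteq> p v"
    "\<exists>u\<in>pverts G. \<exists>v\<in>pverts G. q u \<noteq> q v"
proof -
  from assms obtain X Y :: "nat pair_pre_digraph" where X: "pair_graph X" "2 \<le> card (pverts X)"
    and Y: "pair_graph Y" "2 \<le> card (pverts Y)"
    and iso: "digraph_iso (with_proj G) (with_proj (cartesian_product X Y))"
    by (auto simp: cartesian_product_type_def)
  interpret X: pair_graph X by (rule X)
  interpret Y: pair_graph Y by (rule Y)
  from iso obtain h where h: "bij_betw h (pverts G) (pverts X \<times> pverts Y)"
    and arc: "\<And>u v. u \<in> pverts G \<Longrightarrow> v \<in> pverts G \<Longrightarrow>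
      (h u, h v) \<in> parcs (cartesian_product X Y) \<longleftrightarrow> (u, v) \<in> parcs G"
    by (elim digraph_iso_with_projE) (auto simp: cartesian_product_def)
  have arcD: "fst (h u) = fst (h v) \<and> fst (h u) \<in> pverts X \<and> (snd (h u), snd (h v)) \<in> parcs Y \<or>
      snd (h u) = snd (h v) \<and> snd (h u) \<in> pverts Y \<and> (fst (h u), fst (h v)) \<in> parcs X"
    if "(u, v) \<in> parcs G" for u v
    using arc[of u v] that wellformed'[OF that] by (auto simp: cartesian_product_def)
  have two: "\<exists>x\<in>A. \<exists>y\<in>A. x \<noteq> y" if "2 \<le> card A" for A :: "nat set"
    using that by (metis card_le_Suc0_iff_eq card.infinite not_less_eq_eq numeral_2_eq_2 zero_le)
  have pre: "\<exists>u\<in>pverts G. h u = z" if "z \<in> pverts X \<times> pverts Y" for z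
    using h that by (metis bij_betw_imp_surj_on imageE)
  obtain x0 x1 y0 y1 where xy: "x0 \<in> pverts X" "x1 \<in> pverts X" "x0 \<noteq> x1"
    "y0 \<in> pverts Y" "y1 \<in> pverts Y" "y0 \<noteq> y1"
    using two[OF X(2)] two[OF Y(2)] by blast
  show thesis
  proof (rule that[of "fst \<circ> h" "snd \<circ> h"])
    show "(fst \<circ> h) u = (fst \<circ> h) v \<or> (snd \<circ> h) u = (snd \<circ> h) v" if "(u, v) \<in> parcs G" for u v
      using arcD[OF that] by auto
    show "\<exists>u\<in>pverts G. \<exists>v\<in>pverts G. (fst \<circ> h) u \<noteq> (fst \<circ> h) v"
      using pre[of "(x0, y0)"] pre[of "(x1, y0)"] xy by (metis SigmaI comp_apply fst_conv)
    show "\<exists>u\<in>pverts G. \<exists>v\<in>pverts G. (snd \<circ> h) u \<noteq> (snd \<circ> h) v"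
      using pre[of "(x0, y0)"] pre[of "(x0, y1)"] xy by (metis SigmaI comp_apply snd_conv)
    fix u v w
    assume uv: "(u, v) \<in> parcs G" "(fst \<circ> h) u = (fst \<circ> h) v"
      and uw: "(u, w) \<in> parcs G" "(snd \<circ> h) u = (snd \<circ> h) w"
    have V: "u \<in> pverts G" "v \<in> pverts G" "w \<in> pverts G"
      using uv uw wellformed' by blast+
    have Y': "(snd (h u), snd (h v)) \<in> parcs Y" and X': "(fst (h u), fst (h w)) \<in> parcs X"
      using arcD[OF uv(1)] arcD[OF uw(1)] uv uw X.no_loops' Y.no_loops' by fastforce+
    \<comment> \<open>Both factors are loopless, so the arc to \<open>v\<close> moves only in
      \<open>Y\<close> and the arc to \<open>w\<close> only in \<open>X\<close>; making both moves
      gives the fourth corner of the square.\<close>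
    obtain t where t: "t \<in> pverts G" "h t = (fst (h w), snd (h v))"
      using pre[of "(fst (h w), snd (h v))"] X.wellformed'[OF X'] Y.wellformed'[OF Y'] by auto
    have "t \<noteq> u" using t X' X.no_loops' by fastforce
    moreover have "(v, t) \<in> parcs G"
      using arc[of v t] t V X' Y' uv Y.wellformed'[OF Y'] by (cases "h v") (auto simp: cartesian_product_def)
    moreover have "(w, t) \<in> parcs G"
      using arc[of w t] t V X' Y' uw X.wellformed'[OF X'] by (cases "h w") (auto simp: cartesian_product_def)
    ultimately show "\<exists>t. t \<noteq> u \<and> (v, t) \<in> parcs G \<and> (w, t) \<in> parcs G" by blast
  qed
qed

subsection \<open>Twisted Petersen bundles over cycles\<close>

locale petersen_bundle =
  fixes n :: int
  assumes n_ge: "7 \<le> n"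
begin

text \<open>
  \<open>vtx a c b\<close> lies over the point \<open>a\<close> of the base cycle. Its fibre is the generalized Petersen
  graph \<open>GP(5, 2)\<close>: \<open>c\<close> is a position modulo 5 and \<open>b\<close> tells the inner from the outer pentagon.
  Going once around the base rotates the fibre, \<open>vtx (a + n) c b = vtx a (c + 1) b\<close>, so that each
  layer is a circulant graph modulo \<open>5 n\<close>.
\<close>

definition vtx :: "int \<Rightarrow> int \<Rightarrow> bool \<Rightarrow> nat" where
  "vtx a c b = 2 * nat ((a + c * n) mod (5 * n)) + of_bool b"

text \<open>The 2 is that of \<open>GP(5, 2)\<close>: the inner layer, \<open>True\<close>, is a
  pentagram, so the fibre avoids the 4-cycles of a prism.\<close>

definition turn :: "bool \<Rightarrow> int" where
  "turn b = (if b then 2 else 1)"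

definition forward_arcs :: "(nat \<times> nat) set" where
  "forward_arcs = {(vtx a c b, vtx (a + 1) c b) |a c b. True} \<union> {(vtx a c b, vtx a (c + turn b) b) |a c b. True}
     \<union> {(vtx a c False, vtx a c True) |a c. True}"

definition total_graph :: "nat pair_pre_digraph" where
  "total_graph = \<lparr>pverts = {..<10 * nat n}, parcs = forward_arcs \<union> forward_arcs\<inverse>\<rparr>"

section \<open>Arithmetic of the bundle coordinates\<close>

lemma vtx_eq_mod_iff:
  "vtx a c b = vtx a' c' b' \<longleftrightarrow> b = b' \<and> (a + c * n) mod (5 * n) = (a' + c' * n) mod (5 * n)"
proof -
  have *: "2 * i + of_bool b = 2 * j + of_bool b' \<longleftrightarrow> b = b' \<and> i = j" for i j :: nat
    by (cases b; cases b') (simp_all, presburger+)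
  have "0 \<le> i mod (5 * n)" for i using n_ge by simp
  then show ?thesis unfolding vtx_def * by (simp only: eq_nat_nat_iff)
qed

text \<open>Translations act on vertices, so the neighbours of a vertex do not depend on the
  coordinates chosen for it. The layer \<open>d\<close> is free because a spoke changes the
  layer.\<close>

lemma vtx_shift:
  assumes "vtx a c b = vtx a' c' b'"
  shows "vtx (a + i) (c + j) d = vtx (a' + i) (c' + j) d"
proof -
  have "(a + c * n + (i + j * n)) mod (5 * n) = (a' + c' * n + (i + j * n)) mod (5 * n)"
    using assms unfolding vtx_eq_mod_iff by (intro mod_add_cong[OF _ refl]) blast
  then show ?thesis unfolding vtx_eq_mod_iff by (simp add: algebra_simps)
qed

text \<open>Within less than one turn of the base the rotation is not felt: \<open>n\<close> divides
  \<open>a - a'\<close>, hence \<open>a = a'\<close>, and only the position modulo 5 is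
  left.\<close>

lemma vtx_eq_iff:
  assumes "\<bar>a - a'\<bar> < n"
  shows "vtx a c b = vtx a' c' b' \<longleftrightarrow> b = b' \<and> a = a' \<and> 5 dvd c - c'"
proof -
  have "a = a'" if "5 * n dvd (a - a') + (c - c') * n"
  proof -
    have "n dvd a - a'" using that by (metis dvd_add_left_iff dvd_mult_right dvd_triv_right)
    then show ?thesis using assms zdvd_imp_le[of n "\<bar>a - a'\<bar>"] by fastforce
  qed
  then have "5 * n dvd (a - a') + (c - c') * n \<longleftrightarrow> a = a' \<and> 5 dvd c - c'"
    using n_ge by auto
  then show ?thesis unfolding vtx_eq_mod_iff mod_eq_dvd_iff by (simp add: algebra_simps)
qed

lemma vtx_turn: "vtx (a + m * n) c b = vtx a (c + m) b"
  unfolding vtx_eq_mod_iff by (simp add: algebra_simps)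

lemma parcs_eq: "parcs total_graph = forward_arcs \<union> forward_arcs\<inverse>"
  by (simp add: total_graph_def)

lemma vtx_in_pverts [simp]: "vtx a c b \<in> pverts total_graph"
proof -
  define k where "k = nat ((a + c * n) mod (5 * n))"
  have "k < nat (5 * n)" unfolding k_def using n_ge by (subst nat_less_eq_zless) simp_all
  moreover have "nat (5 * n) = 5 * nat n" using n_ge by simp
  ultimately show ?thesis by (auto simp: total_graph_def vtx_def k_def[symmetric])
qed

text \<open>Five turns of the base run through a whole layer, so position 0 suffices, and a natural
  base coordinate permits induction.\<close>

lemma pverts_total_graph_cases:
  assumes "v \<in> pverts total_graph"
  obtains a b where "v = vtx (int a) 0 b"
proof
  have "v div 2 < 5 * nat n" using assms by (auto simp: total_graph_def)
  then have "int (v div 2) mod (5 * n) = int (v div 2)" using n_ge by simp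
  then show "v = vtx (int (v div 2)) 0 (odd v)" by (simp add: vtx_def)
qed

section \<open>Adjacency, regularity and connectedness\<close>

lemma parcs_total_graph [intro]:
  "(vtx a c b, vtx (a + 1) c b) \<in> parcs total_graph"
  "(vtx a c b, vtx (a - 1) c b) \<in> parcs total_graph"
  "(vtx a c b, vtx a (c + turn b) b) \<in> parcs total_graph"
  "(vtx a c b, vtx a (c - turn b) b) \<in> parcs total_graph"
  "(vtx a c b, vtx a c (\<not> b)) \<in> parcs total_graph"
proof -
  have 1: "(vtx a c b, vtx (a + 1) c b) \<in> forward_arcs" for a unfolding forward_arcs_def by blast
  have 2: "(vtx a c b, vtx a (c + turn b) b) \<in> forward_arcs" for c unfolding forward_arcs_def by blast
  show "(vtx a c b, vtx (a + 1) c b) \<in> parcs total_graph"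
    "(vtx a c b, vtx (a - 1) c b) \<in> parcs total_graph"
    "(vtx a c b, vtx a (c + turn b) b) \<in> parcs total_graph"
    "(vtx a c b, vtx a (c - turn b) b) \<in> parcs total_graph"
    using 1[of a] 1[of "a - 1"] 2[of c] 2[of "c - turn b"] by (simp_all add: parcs_eq)
  have 3: "(vtx a c False, vtx a c True) \<in> forward_arcs" unfolding forward_arcs_def by blast
  then show "(vtx a c b, vtx a c (\<not> b)) \<in> parcs total_graph"
    by (cases b) (simp_all add: parcs_eq)
qed

lemma nbhd_total_graph:
  "nbhd total_graph (vtx a c b) =
    {vtx (a + 1) c b, vtx (a - 1) c b, vtx a (c + turn b) b, vtx a (c - turn b) b, vtx a c (\<not> b)}"
    (is "_ = ?N")
proof (intro equalityI subsetI)
  fix z assume "z \<in> nbhd total_graph (vtx a c b)"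
  then have "(vtx a c b, z) \<in> forward_arcs \<or> (z, vtx a c b) \<in> forward_arcs"
    by (auto simp: nbhd_def parcs_eq)
  then show "z \<in> ?N"
  proof
    assume "(vtx a c b, z) \<in> forward_arcs"
    then consider (base) a' c' b' where "vtx a c b = vtx a' c' b'" "z = vtx (a' + 1) c' b'"
      | (fibre) a' c' b' where "vtx a c b = vtx a' c' b'" "z = vtx a' (c' + turn b') b'"
      | (spoke) a' c' where "vtx a c b = vtx a' c' False" "z = vtx a' c' True"
      by (auto simp: forward_arcs_def)
    then show ?thesis
    proof cases
      case base
      then have "b' = b" by (simp only: vtx_eq_mod_iff)
      then show ?thesis using vtx_shift[OF base(1), of 1 0 b] base(2) by simp
    next
      case fibre
      then have "b' = b" by (simp only: vtx_eq_mod_iff)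
      then show ?thesis using vtx_shift[OF fibre(1), of 0 "turn b" b] fibre(2) by simp
    next
      case spoke
      then have "\<not> b" by (simp add: vtx_eq_mod_iff)
      then show ?thesis using vtx_shift[OF spoke(1), of 0 0 True] spoke(2) by simp
    qed
  next
    assume "(z, vtx a c b) \<in> forward_arcs"
    then consider (base) a' c' b' where "vtx a c b = vtx (a' + 1) c' b'" "z = vtx a' c' b'"
      | (fibre) a' c' b' where "vtx a c b = vtx a' (c' + turn b') b'" "z = vtx a' c' b'"
      | (spoke) a' c' where "vtx a c b = vtx a' c' True" "z = vtx a' c' False"
      by (auto simp: forward_arcs_def)
    then show ?thesis
    proof cases
      case base
      then have "b' = b" by (simp only: vtx_eq_mod_iff)
      then show ?thesis using vtx_shift[OF base(1), of "- 1" 0 b] base(2) by simp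
    next
      case fibre
      then have "b' = b" by (simp only: vtx_eq_mod_iff)
      then show ?thesis using vtx_shift[OF fibre(1), of 0 "- turn b" b] fibre(2) by simp
    next
      case spoke
      then have b by (simp add: vtx_eq_mod_iff)
      then show ?thesis using vtx_shift[OF spoke(1), of 0 0 False] spoke(2) by simp
    qed
  qed
qed (auto simp: nbhd_def)

lemma parcs_total_graph_cases:
  assumes "(u, v) \<in> parcs total_graph"
  obtains a b where "u = vtx (int a) 0 b" "v \<in> nbhd total_graph u"
proof -
  have "u \<in> pverts total_graph" using assms by (auto simp: parcs_eq forward_arcs_def)
  then show thesis using assms that by (elim pverts_total_graph_cases) (auto simp: nbhd_def)
qed

lemma distinct_nbhd:
  "distinct [vtx (a + 1) c b, vtx (a - 1) c b, vtx a (c + turn b) b, vtx a (c - turn b) b, vtx a c (\<not> b)]"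
  using n_ge by (simp add: vtx_eq_iff turn_def)

lemma card_nbhd_total_graph:
  assumes "v \<in> pverts total_graph"
  shows "card (nbhd total_graph v) = 5"
  using assms
proof (cases rule: pverts_total_graph_cases)
  case (1 a b)
  then show ?thesis using distinct_card[OF distinct_nbhd[of "int a" 0 b]] by (simp add: nbhd_total_graph)
qed

sublocale pair_graph total_graph
proof
  show "symmetric (with_proj total_graph)"
    by (auto simp: symmetric_def total_graph_def sym_def)
  show "finite (pverts total_graph)" by (simp add: total_graph_def)
  fix e assume e: "e \<in> parcs total_graph"
  then have "(fst e, snd e) \<in> parcs total_graph" by simp
  then obtain a b where ab: "fst e = vtx (int a) 0 b" "snd e \<in> nbhd total_graph (vtx (int a) 0 b)"
    by (metis parcs_total_graph_cases)
  then show "fst e \<in> pverts total_graph" "snd e \<in> pverts total_graph" by (auto simp: nbhd_total_graph)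
  show "fst e \<noteq> snd e" using ab n_ge by (auto simp: nbhd_total_graph vtx_eq_iff turn_def split: if_splits)
next
  have "parcs total_graph \<subseteq> pverts total_graph \<times> pverts total_graph"
    by (auto elim!: parcs_total_graph_cases simp: nbhd_total_graph)
  then show "finite (parcs total_graph)"
    by (rule finite_subset) (simp add: total_graph_def)
qed

lemma connected_total_graph: "Digraph_Component.connected (with_proj total_graph)"
proof -
  have base: "vtx 0 0 False \<rightarrow>\<^sup>*\<^bsub>with_proj total_graph\<^esub> vtx (int a) 0 False" for a
  proof (induction a)
    case (Suc a)
    then show ?case
      using parcs_total_graph(1)[of "int a" 0 False] by (auto intro: reachable_adj_trans simp: add.commute)
  qed simp
  have from_0: "vtx 0 0 False \<rightarrow>\<^sup>*\<^bsub>with_proj total_graph\<^esub> v" if v: "v \<in> pverts total_graph" for v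
  proof -
    obtain a b where "v = vtx (int a) 0 b" using v by (rule pverts_total_graph_cases)
    then show ?thesis
      using base[of a] parcs_total_graph(5)[of "int a" 0 False] by (cases b) (auto intro: reachable_adj_trans)
  qed
  have "strongly_connected (with_proj total_graph)"
  proof
    show "verts (with_proj total_graph) \<noteq> {}" using vtx_in_pverts by (auto simp del: vtx_in_pverts)
    fix u v assume "u \<in> verts (with_proj total_graph)" "v \<in> verts (with_proj total_graph)"
    then show "u \<rightarrow>\<^sup>*\<^bsub>with_proj total_graph\<^esub> v"
      using symmetric_reachable'[OF from_0[of u]] from_0[of v] by (auto intro: reachable_trans)
  qed
  then show ?thesis
    using reachable_mk_symmetric_eq[OF sym_arcs]
    by (auto simp: Digraph_Component.connected_def strongly_connected_def)
qed

lemma regular_total_graph: "regular 5 total_graph"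
  by (simp add: regular_def card_nbhd_total_graph)

lemma card_pverts_total_graph: "card (pverts total_graph) = 10 * nat n"
  by (simp add: total_graph_def)

section \<open>Lipschitz functions compatible with the rotation\<close>

lemma ex_lipschitz:
  fixes g :: "int \<Rightarrow> int \<Rightarrow> bool \<Rightarrow> int"
  assumes g_turn: "\<And>a c m b. g (a + m * n) c b = g a (c + m) b"
    and g_period: "\<And>a c m b. g a (c + 5 * m) b = g a c b"
    and g_base: "\<And>a c b. \<bar>g (a + 1) c b - g a c b\<bar> \<le> 1"
    and g_fibre: "\<And>a c b. \<bar>g a (c + turn b) b - g a c b\<bar> \<le> 1"
    and g_spoke: "\<And>a c. \<bar>g a c True - g a c False\<bar> \<le> 1"
  obtains F :: "nat \<Rightarrow> real" where "\<And>u v. (u, v) \<in> parcs total_graph \<Longrightarrow> F u - F v \<le> 1"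
    "\<And>a c b. F (vtx a c b) = real_of_int (g a c b)"
proof
  \<comment> \<open>Reads \<open>g\<close> at the representative with position 0. Any other one
    differs by turns, which \<open>g_turn\<close> converts into rotations, and by multiples of five
    rotations, which \<open>g_period\<close> absorbs.\<close>
  define F where "F v = real_of_int (g (int (v div 2)) 0 (odd v))" for v
  show F: "F (vtx a c b) = real_of_int (g a c b)" for a c b
  proof -
    define m where "m = (a + c * n) div (5 * n)"
    have "int (vtx a c b div 2) = (a + c * n) mod (5 * n)"
      using n_ge by (simp add: vtx_def)
    also have "\<dots> = a + (c - 5 * m) * n"
      by (simp add: m_def algebra_simps flip: minus_div_mult_eq_mod)
    finally have "F (vtx a c b) = real_of_int (g (a + (c - 5 * m) * n) 0 b)" by (simp add: F_def vtx_def)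
    also have "\<dots> = real_of_int (g a (c + 5 * (- m)) b)" by (simp add: g_turn)
    also have "\<dots> = real_of_int (g a c b)" by (simp only: g_period)
    finally show ?thesis .
  qed
  fix u v assume "(u, v) \<in> parcs total_graph"
  then obtain a b where u: "u = vtx (int a) 0 b" and v: "v \<in> nbhd total_graph u"
    by (rule parcs_total_graph_cases)
  then show "F u - F v \<le> 1"
    using g_base[of "int a" 0 b] g_base[of "int a - 1" 0 b] g_fibre[of "int a" 0 b]
      g_fibre[of "int a" "- turn b" b] g_spoke[of "int a" 0]
    by (cases b) (auto simp: nbhd_total_graph F)
qed

lemma add_1_mod_div:
  "(t + 1) mod n = (if t mod n = n - 1 then 0 else t mod n + 1)"
  "t mod n \<noteq> n - 1 \<Longrightarrow> (t + 1) div n = t div n"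
proof -
  have r: "0 \<le> t mod n" "t mod n < n" using n_ge by auto
  have t: "t + 1 = (t mod n + 1) + t div n * n" by simp
  show "(t + 1) mod n = (if t mod n = n - 1 then 0 else t mod n + 1)"
    using r by (subst t, subst mod_mult_self1) auto
  show "(t + 1) div n = t div n" if "t mod n \<noteq> n - 1"
  proof -
    have "(t mod n + 1) div n = 0" using r that by (intro div_pos_pos_trivial) auto
    then show ?thesis using n_ge by (subst t, subst div_mult_self1) auto
  qed
qed

text \<open>
  The reversed base coordinate near \<open>a0\<close>, folded back so that it closes up around the cycle.
\<close>

lemma ex_base_lipschitz:
  obtains F :: "nat \<Rightarrow> real" where "\<And>u v. (u, v) \<in> parcs total_graph \<Longrightarrow> F u - F v \<le> 1"
    "\<And>a c b. a0 - 1 \<le> a \<Longrightarrow> a \<le> a0 + 2 \<Longrightarrow> F (vtx a c b) = real_of_int (a0 + 1 - a)"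
proof -
  \<comment> \<open>From \<open>a0 - 1\<close> on, the values are 2, 1, 0, -1, 0, 1, 2; the cap then
    holds the value 2 until the cycle closes, where the pattern restarts with 2.\<close>
  define g :: "int \<Rightarrow> int \<Rightarrow> bool \<Rightarrow> int"
    where "g a c b = min 2 (\<bar>(a - a0 + 1) mod n - 3\<bar> - 1)" for a c b
  obtain F :: "nat \<Rightarrow> real" where lip: "\<And>u v. (u, v) \<in> parcs total_graph \<Longrightarrow> F u - F v \<le> 1"
    and F: "\<And>a c b. F (vtx a c b) = real_of_int (g a c b)"
  proof (rule ex_lipschitz[of g])
    show "g (a + m * n) c b = g a (c + m) b" for a c m b
      using mod_mult_self1[of "a - a0 + 1" m n] by (simp add: g_def algebra_simps)
    show "\<bar>g (a + 1) c b - g a c b\<bar> \<le> 1" for a c b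
    proof -
      have "\<bar>min 2 (\<bar>(t + 1) mod n - 3\<bar> - 1) - min 2 (\<bar>t mod n - 3\<bar> - 1)\<bar> \<le> 1" for t
        using n_ge pos_mod_bound[of n t] pos_mod_sign[of n t] unfolding add_1_mod_div by (auto split: if_splits)
      from this[of "a - a0 + 1"] show ?thesis
        by (simp add: g_def algebra_simps)
    qed
  qed (blast | simp add: g_def)+
  show thesis
  proof (rule that[OF lip])
    fix a c b assume "a0 - 1 \<le> a" "a \<le> a0 + 2"
    moreover from this have "(a - a0 + 1) mod n = a - a0 + 1" using n_ge by simp
    ultimately show "F (vtx a c b) = real_of_int (a0 + 1 - a)" by (simp add: F g_def)
  qed
qed

text \<open>
  A function on the fibre extends constantly to the neighbouring fibres and is then cut down to \<open>0\<close>
  within three steps in either direction, before the rotation of the fibre is felt.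
\<close>

lemma ex_fibre_lipschitz:
  fixes T :: "int \<Rightarrow> bool \<Rightarrow> int"
  assumes T_range: "\<And>i b. i \<in> {0, 1, 2, 3, 4} \<Longrightarrow> 0 \<le> T i b \<and> T i b \<le> 2"
    and T_fibre: "\<And>i b. i \<in> {0, 1, 2, 3, 4} \<Longrightarrow> \<bar>T ((i + turn b) mod 5) b - T i b\<bar> \<le> 1"
    and T_spoke: "\<And>i. i \<in> {0, 1, 2, 3, 4} \<Longrightarrow> \<bar>T i True - T i False\<bar> \<le> 1"
  obtains F :: "nat \<Rightarrow> real" where "\<And>u v. (u, v) \<in> parcs total_graph \<Longrightarrow> F u - F v \<le> 1"
    "\<And>a c b. \<bar>a - a0\<bar> \<le> 1 \<Longrightarrow> F (vtx a c b) = real_of_int (T ((c - c0) mod 5) b)"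
proof -
  have mod5: "i mod 5 \<in> {0, 1, 2, 3, 4}" for i :: int by auto
  \<comment> \<open>With \<open>t = a - a0 + 3\<close> the point \<open>a0\<close> sits at 3, the
    middle of the window from 0 to 6. Each completed turn adds one rotation, so \<open>q\<close>
    jumps only where \<open>t\<close> wraps around.\<close>
  define q where "q t c = (c - c0 + t div n) mod 5" for t c
  \<comment> \<open>A tent with peak 3 at residue 3. It is at least 2, the maximum of
    \<open>T\<close>, on the fibres next to \<open>a0\<close>, and as \<open>7 \<le> n\<close> it is
    0 on both sides of the wrap-around, hiding the jump of \<open>q\<close>.\<close>
  define w where "w t = max 0 (3 - \<bar>t mod n - 3\<bar>)" for t
  define g where "g a c b = min (T (q (a - a0 + 3) c) b) (w (a - a0 + 3))" for a c b
  have q5: "q t c \<in> {0, 1, 2, 3, 4}" for t c unfolding q_def by (rule mod5)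
  have min: "\<bar>min x z - min y z\<bar> \<le> 1" if "\<bar>x - y\<bar> \<le> 1" for x y z :: int using that by linarith
  obtain F :: "nat \<Rightarrow> real" where lip: "\<And>u v. (u, v) \<in> parcs total_graph \<Longrightarrow> F u - F v \<le> 1"
    and F: "\<And>a c b. F (vtx a c b) = real_of_int (g a c b)"
  proof (rule ex_lipschitz[of g])
    fix a c m b
    have "q (t + m * n) c = q t (c + m)" "w (t + m * n) = w t" for t
      using n_ge by (simp_all add: q_def w_def algebra_simps)
    from this[of "a - a0 + 3"] show "g (a + m * n) c b = g a (c + m) b"
      by (simp add: g_def algebra_simps)
    have "q t (c + 5 * m) = q t c" for t
      using mod_mult_self2[of "c - c0 + t div n" 5 m] by (simp add: q_def algebra_simps)
    then show "g a (c + 5 * m) b = g a c b" by (simp add: g_def)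
    show "\<bar>g (a + 1) c b - g a c b\<bar> \<le> 1"
    proof -
      have "\<bar>min (T (q (t + 1) c) b) (w (t + 1)) - min (T (q t c) b) (w t)\<bar> \<le> 1" for t
      proof (cases "t mod n = n - 1")
        case True
        then have "w t = 0" "w (t + 1) = 0" using n_ge by (auto simp: w_def add_1_mod_div)
        then show ?thesis using T_range[OF q5] by (simp add: min_absorb2)
      next
        case False
        then have "q (t + 1) c = q t c" "\<bar>w (t + 1) - w t\<bar> \<le> 1"
          by (auto simp: q_def w_def add_1_mod_div)
        then show ?thesis using min[of "w (t + 1)" "w t"] by (simp add: min.commute)
      qed
      from this[of "a - a0 + 3"] show ?thesis
        by (simp add: g_def algebra_simps)
    qed
    have "q t (c + turn b) = (q t c + turn b) mod 5" for t
      by (simp add: q_def mod_simps algebra_simps)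
    then show "\<bar>g a (c + turn b) b - g a c b\<bar> \<le> 1"
      using min[OF T_fibre[OF q5]] by (simp add: g_def)
    show "\<bar>g a c True - g a c False\<bar> \<le> 1"
      using min[OF T_spoke[OF q5]] by (simp add: g_def)
  qed blast
  show thesis
  proof (rule that[OF lip])
    fix a c b assume a: "\<bar>a - a0\<bar> \<le> 1"
    then have "0 \<le> a - a0 + 3" "a - a0 + 3 < n" using n_ge by auto
    then have "(a - a0 + 3) mod n = a - a0 + 3" "(a - a0 + 3) div n = 0" by simp_all
    then have "2 \<le> w (a - a0 + 3)" "q (a - a0 + 3) c = (c - c0) mod 5"
      using a by (auto simp: w_def q_def)
    then show "F (vtx a c b) = real_of_int (T ((c - c0) mod 5) b)"
      using T_range[OF mod5, of "c - c0" b] by (simp add: F g_def)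
  qed
qed

section \<open>Flatness of the four kinds of arcs\<close>

lemma graph_dist_le_1: "(u, v) \<in> parcs total_graph \<Longrightarrow> graph_dist total_graph u v \<le> 1"
  using graph_dist_le_length[of u "[(u, v)]" v] wellformed' by (simp add: awalk_simps)

lemma graph_dist_le_2:
  "(u, s) \<in> parcs total_graph \<Longrightarrow> (s, v) \<in> parcs total_graph \<Longrightarrow> graph_dist total_graph u v \<le> 2"
  using graph_dist_le_length[of u "[(u, s), (s, v)]" v] wellformed' by (simp add: awalk_simps)

lemma graph_dist_le_3:
  "(u, s) \<in> parcs total_graph \<Longrightarrow> (s, t) \<in> parcs total_graph \<Longrightarrow> (t, v) \<in> parcs total_graph \<Longrightarrow>
    graph_dist total_graph u v \<le> 3"
  using graph_dist_le_length[of u "[(u, s), (s, t), (t, v)]" v] wellformed' by (simp add: awalk_simps)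

lemma vtx_cong: "a = a' \<Longrightarrow> 5 dvd c - c' \<Longrightarrow> vtx a c b = vtx a' c' b"
  using n_ge by (simp add: vtx_eq_iff)

definition flat :: "nat \<Rightarrow> nat \<Rightarrow> bool" where
  "flat u v \<longleftrightarrow> lly_curvature total_graph u v = 0 \<and> lly_curvature total_graph v u = 0"

text \<open>The outermost base neighbours are matched along the cycle at cost 3, the fibre
  neighbours by parallel base arcs at cost 1 each. \<open>F\<close> drops by 1 per base step and so
  by exactly these amounts.\<close>

lemma flat_base: "flat (vtx a c b) (vtx (a + 1) c b)"
proof -
  obtain F :: "nat \<Rightarrow> real" where lip: "\<And>u v. (u, v) \<in> parcs total_graph \<Longrightarrow> F u - F v \<le> 1"
    and F: "\<And>i c b. a - 1 \<le> i \<Longrightarrow> i \<le> a + 2 \<Longrightarrow> F (vtx i c b) = real_of_int (a + 1 - i)"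
    by (rule ex_base_lipschitz[of a]) blast
  let ?zs = "[vtx (a - 1) c b, vtx a (c + turn b) b, vtx a (c - turn b) b, vtx a c (\<not> b)]"
  let ?ws = "[vtx (a + 2) c b, vtx (a + 1) (c + turn b) b, vtx (a + 1) (c - turn b) b, vtx (a + 1) c (\<not> b)]"
  have 3: "graph_dist total_graph (vtx (a - 1) c b) (vtx (a + 2) c b) \<le> 3"
    using parcs_total_graph(1)[of "a - 1" c b] parcs_total_graph(1)[of a c b] parcs_total_graph(1)[of "a + 1" c b]
    by (intro graph_dist_le_3[of _ "vtx a c b" "vtx (a + 1) c b"]) (simp_all add: add.commute)
  have 1: "graph_dist total_graph (vtx a i d) (vtx (a + 1) i d) \<le> 1" for i d
    by (intro graph_dist_le_1) auto
  show ?thesis unfolding flat_def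
  proof (rule lly_curvature_eq_0_both[where zs = ?zs and ws = ?ws and F = F])
    show "nbhd total_graph (vtx a c b) = set (vtx (a + 1) c b # ?zs)"
      "nbhd total_graph (vtx (a + 1) c b) = set (vtx a c b # ?ws)"
      by (auto simp: nbhd_total_graph add.commute)
    show "distinct (vtx (a + 1) c b # ?zs)" "distinct (vtx a c b # ?ws)"
      using n_ge by (simp_all add: vtx_eq_iff turn_def)
    show "sum_list (map2 (graph_dist total_graph) ?zs ?ws) \<le> length ?zs + 2"
      using 3 1[of "c + turn b" b] 1[of "c - turn b" b] 1[of c "\<not> b"] by simp
  qed (use lip in \<open>auto simp: F intro: connected_total_graph\<close>)
qed

text \<open>
  For a fibre arc from \<open>x\<close> to \<open>y\<close>, \<open>T\<close> is \<open>2\<close> on the other fibre neighbours of \<open>x\<close>, \<open>0\<close> on \<open>y\<close>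
  and its other fibre neighbours, and \<open>1\<close> elsewhere.
\<close>

lemma flat_outer: "flat (vtx a c False) (vtx a (c + 1) False)"
proof -
  define T :: "int \<Rightarrow> bool \<Rightarrow> int" where "T i b = (if b then [2, 0, 1, 1, 1] else [1, 0, 0, 1, 2]) ! nat i" for i b
  obtain F :: "nat \<Rightarrow> real" where lip: "\<And>u v. (u, v) \<in> parcs total_graph \<Longrightarrow> F u - F v \<le> 1"
    and F: "\<And>i j b. \<bar>i - a\<bar> \<le> 1 \<Longrightarrow> F (vtx i j b) = real_of_int (T ((j - c) mod 5) b)"
    by (rule ex_fibre_lipschitz[of T a c]) (auto simp: T_def turn_def)
  let ?zs = "[vtx (a + 1) c False, vtx (a - 1) c False, vtx a (c - 1) False, vtx a c True]"
  let ?ws = "[vtx (a + 1) (c + 1) False, vtx (a - 1) (c + 1) False, vtx a (c + 2) False, vtx a (c + 1) True]"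
  have 1: "graph_dist total_graph (vtx i c False) (vtx i (c + 1) False) \<le> 1" for i
    using parcs_total_graph(3)[of i c False] by (intro graph_dist_le_1) (simp add: turn_def)
  \<comment> \<open>The pentagon is traversed the other way round, as \<open>c - 3\<close> and
    \<open>c + 2\<close> agree modulo 5.\<close>
  have 2: "graph_dist total_graph (vtx a (c - 1) False) (vtx a (c + 2) False) \<le> 2"
    using parcs_total_graph(4)[of a "c - 1" False] parcs_total_graph(4)[of a "c - 2" False]
      vtx_cong[of a a "c - 3" "c + 2" False]
    by (intro graph_dist_le_2[of _ "vtx a (c - 2) False"]) (simp_all add: turn_def add.commute)
  \<comment> \<open>Two pentagram steps back, as \<open>c - 4\<close> and \<open>c + 1\<close> agree
    modulo 5.\<close>
  have 3: "graph_dist total_graph (vtx a c True) (vtx a (c + 1) True) \<le> 2"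
    using parcs_total_graph(4)[of a c True] parcs_total_graph(4)[of a "c - 2" True]
      vtx_cong[of a a "c - 4" "c + 1" True]
    by (intro graph_dist_le_2[of _ "vtx a (c - 2) True"]) (simp_all add: turn_def add.commute)
  show ?thesis unfolding flat_def
  proof (rule lly_curvature_eq_0_both[where zs = ?zs and ws = ?ws and F = F])
    show "nbhd total_graph (vtx a c False) = set (vtx a (c + 1) False # ?zs)"
      "nbhd total_graph (vtx a (c + 1) False) = set (vtx a c False # ?ws)"
      by (auto simp: nbhd_total_graph turn_def add.assoc)
    show "distinct (vtx a (c + 1) False # ?zs)" "distinct (vtx a c False # ?ws)"
      using n_ge by (simp_all add: vtx_eq_iff)
    show "sum_list (map2 (graph_dist total_graph) ?zs ?ws) \<le> length ?zs + 2"
      using 1[of "a + 1"] 1[of "a - 1"] 2 3 by simp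
    show "(vtx a c False, vtx a (c + 1) False) \<in> parcs total_graph"
      using parcs_total_graph(3)[of a c False] by (simp add: turn_def)
  qed (use lip in \<open>auto simp: F T_def intro: connected_total_graph\<close>)
qed

text \<open>The certificate is that of \<open>flat_outer\<close> with positions doubled and layers
  exchanged, an automorphism of the Petersen graph. It turns the rotation by 1 into one by 2, hence
  does not extend to the bundle, and the certificate is checked anew.\<close>

lemma flat_inner: "flat (vtx a c True) (vtx a (c + 2) True)"
proof -
  define T :: "int \<Rightarrow> bool \<Rightarrow> int" where "T i b = (if b then [1, 1, 0, 2, 0] else [2, 1, 0, 1, 1]) ! nat i" for i b
  obtain F :: "nat \<Rightarrow> real" where lip: "\<And>u v. (u, v) \<in> parcs total_graph \<Longrightarrow> F u - F v \<le> 1"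
    and F: "\<And>i j b. \<bar>i - a\<bar> \<le> 1 \<Longrightarrow> F (vtx i j b) = real_of_int (T ((j - c) mod 5) b)"
    by (rule ex_fibre_lipschitz[of T a c]) (auto simp: T_def turn_def)
  let ?zs = "[vtx (a + 1) c True, vtx (a - 1) c True, vtx a (c - 2) True, vtx a c False]"
  let ?ws = "[vtx (a + 1) (c + 2) True, vtx (a - 1) (c + 2) True, vtx a (c + 4) True, vtx a (c + 2) False]"
  have 1: "graph_dist total_graph (vtx i c True) (vtx i (c + 2) True) \<le> 1" for i
    using parcs_total_graph(3)[of i c True] by (intro graph_dist_le_1) (simp add: turn_def)
  have 2: "graph_dist total_graph (vtx a (c - 2) True) (vtx a (c + 4) True) \<le> 2"
    using parcs_total_graph(4)[of a "c - 2" True] parcs_total_graph(4)[of a "c - 4" True]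
      vtx_cong[of a a "c - 6" "c + 4" True]
    by (intro graph_dist_le_2[of _ "vtx a (c - 4) True"]) (simp_all add: turn_def add.commute)
  have 3: "graph_dist total_graph (vtx a c False) (vtx a (c + 2) False) \<le> 2"
    using parcs_total_graph(3)[of a c False] parcs_total_graph(3)[of a "c + 1" False]
    by (intro graph_dist_le_2[of _ "vtx a (c + 1) False"]) (simp_all add: turn_def add.commute)
  show ?thesis unfolding flat_def
  proof (rule lly_curvature_eq_0_both[where zs = ?zs and ws = ?ws and F = F])
    show "nbhd total_graph (vtx a c True) = set (vtx a (c + 2) True # ?zs)"
      "nbhd total_graph (vtx a (c + 2) True) = set (vtx a c True # ?ws)"
      by (auto simp: nbhd_total_graph turn_def add.assoc)
    show "distinct (vtx a (c + 2) True # ?zs)" "distinct (vtx a c True # ?ws)"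
      using n_ge by (simp_all add: vtx_eq_iff)
    show "sum_list (map2 (graph_dist total_graph) ?zs ?ws) \<le> length ?zs + 2"
      using 1[of "a + 1"] 1[of "a - 1"] 2 3 by simp
    show "(vtx a c True, vtx a (c + 2) True) \<in> parcs total_graph"
      using parcs_total_graph(3)[of a c True] by (simp add: turn_def)
  qed (use lip in \<open>auto simp: F T_def intro: connected_total_graph\<close>)
qed

text \<open>\<open>T\<close> drops by 1 along every spoke and is raised by 1 at the positions 1 and
  4. The pairs at cost 2 take one step on the outer pentagon and then a spoke.\<close>

lemma flat_spoke: "flat (vtx a c False) (vtx a c True)"
proof -
  define T :: "int \<Rightarrow> bool \<Rightarrow> int" where "T i b = (if b then [0, 1, 0, 0, 1] else [1, 2, 1, 1, 2]) ! nat i" for i b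
  obtain F :: "nat \<Rightarrow> real" where lip: "\<And>u v. (u, v) \<in> parcs total_graph \<Longrightarrow> F u - F v \<le> 1"
    and F: "\<And>i j b. \<bar>i - a\<bar> \<le> 1 \<Longrightarrow> F (vtx i j b) = real_of_int (T ((j - c) mod 5) b)"
    by (rule ex_fibre_lipschitz[of T a c]) (auto simp: T_def turn_def)
  let ?zs = "[vtx (a + 1) c False, vtx (a - 1) c False, vtx a (c + 1) False, vtx a (c - 1) False]"
  let ?ws = "[vtx (a + 1) c True, vtx (a - 1) c True, vtx a (c + 2) True, vtx a (c - 2) True]"
  have 1: "graph_dist total_graph (vtx i c False) (vtx i c True) \<le> 1" for i
    using parcs_total_graph(5)[of i c False] by (intro graph_dist_le_1) simp
  have 2: "graph_dist total_graph (vtx a (c + 1) False) (vtx a (c + 2) True) \<le> 2"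
    using parcs_total_graph(3)[of a "c + 1" False] parcs_total_graph(5)[of a "c + 2" False]
    by (intro graph_dist_le_2[of _ "vtx a (c + 2) False"]) (simp_all add: turn_def add.commute)
  have 3: "graph_dist total_graph (vtx a (c - 1) False) (vtx a (c - 2) True) \<le> 2"
    using parcs_total_graph(4)[of a "c - 1" False] parcs_total_graph(5)[of a "c - 2" False]
    by (intro graph_dist_le_2[of _ "vtx a (c - 2) False"]) (simp_all add: turn_def add.commute)
  show ?thesis unfolding flat_def
  proof (rule lly_curvature_eq_0_both[where zs = ?zs and ws = ?ws and F = F])
    show "nbhd total_graph (vtx a c False) = set (vtx a c True # ?zs)"
      "nbhd total_graph (vtx a c True) = set (vtx a c False # ?ws)"
      by (auto simp: nbhd_total_graph turn_def)
    show "distinct (vtx a c True # ?zs)" "distinct (vtx a c False # ?ws)"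
      using n_ge by (simp_all add: vtx_eq_iff)
    show "sum_list (map2 (graph_dist total_graph) ?zs ?ws) \<le> length ?zs + 2"
      using 1[of "a + 1"] 1[of "a - 1"] 2 3 by simp
    show "(vtx a c False, vtx a c True) \<in> parcs total_graph"
      using parcs_total_graph(5)[of a c False] by simp
  qed (use lip in \<open>auto simp: F T_def intro: connected_total_graph\<close>)
qed

lemma ricci_flat_total_graph: "ricci_flat total_graph"
proof -
  have "flat (vtx a c b) (vtx a (c + turn b) b)" for a c b
    using flat_outer[of a c] flat_inner[of a c] by (cases b) (simp_all add: turn_def add.commute)
  then have "flat u v" if "(u, v) \<in> forward_arcs" for u v
    using that flat_base flat_spoke by (auto simp: forward_arcs_def)
  then show ?thesis by (auto simp: ricci_flat_def flat_def parcs_eq)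
qed

section \<open>Failure to be a product\<close>

text \<open>
  Consecutive base arcs lie in no common square, so they all fix the same coordinate, which is
  therefore constant on the outer layer. Because of the rotation this layer is connected by base arcs
  alone, so the outer fibre arcs fix that coordinate as well, and so do the spokes, which lie in no
  common square with them.
\<close>

lemma not_cartesian_product_type_total_graph: "\<not> cartesian_product_type total_graph"
proof
  assume "cartesian_product_type total_graph"
  then obtain p q :: "nat \<Rightarrow> nat" where
    arc: "\<And>u v. (u, v) \<in> parcs total_graph \<Longrightarrow> p u = p v \<or> q u = q v" and
    square: "\<And>u v w. (u, v) \<in> parcs total_graph \<Longrightarrow> (u, w) \<in> parcs total_graph \<Longrightarrow> p u = p v \<Longrightarrow> q u = q w \<Longrightarrow>
       \<exists>t. t \<noteq> u \<and> (v, t) \<in> parcs total_graph \<and> (w, t) \<in> parcs total_graph" and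
    nonconst: "\<exists>u\<in>pverts total_graph. \<exists>v\<in>pverts total_graph. p u \<noteq> p v"
      "\<exists>u\<in>pverts total_graph. \<exists>v\<in>pverts total_graph. q u \<noteq> q v"
    by (rule cartesian_product_typeE) blast
  have swapped_square: "\<exists>t. t \<noteq> u \<and> (v, t) \<in> parcs total_graph \<and> (w, t) \<in> parcs total_graph"
    if "(u, v) \<in> parcs total_graph" "(u, w) \<in> parcs total_graph" "q u = q v" "p u = p w" for u v w
    using square[of u w v] that by blast
  \<comment> \<open>Stated for abstract coordinates \<open>r\<close> and \<open>s\<close>, because
    the first base arc may fix either \<open>p\<close> or \<open>q\<close>.\<close>
  have const: "r u = r v"
    if arc: "\<And>u v. (u, v) \<in> parcs total_graph \<Longrightarrow> r u = r v \<or> s u = s v"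
      and sq: "\<And>u v w. (u, v) \<in> parcs total_graph \<Longrightarrow> (u, w) \<in> parcs total_graph \<Longrightarrow> r u = r v \<Longrightarrow> s u = s w \<Longrightarrow>
       \<exists>t. t \<noteq> u \<and> (v, t) \<in> parcs total_graph \<and> (w, t) \<in> parcs total_graph"
      and start: "r (vtx 0 0 False) = r (vtx 1 0 False)"
      and uv: "u \<in> pverts total_graph" "v \<in> pverts total_graph"
    for r s :: "nat \<Rightarrow> nat" and u v
  proof -
    \<comment> \<open>All base coordinates involved differ by at most 4, which is less than
      \<open>n\<close>, so \<open>vtx_eq_iff\<close> decides every coincidence.\<close>
    have no_sq1: "\<not> (\<exists>t. t \<noteq> vtx a 0 False \<and> (vtx (a - 1) 0 False, t) \<in> parcs total_graph
        \<and> (vtx (a + 1) 0 False, t) \<in> parcs total_graph)" for a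
      using n_ge nbhd_total_graph[of "a - 1" 0 False] nbhd_total_graph[of "a + 1" 0 False]
      by (auto simp: nbhd_def set_eq_iff vtx_eq_iff turn_def)
    \<comment> \<open>In the fibre this is the absence of 4-cycles from the Petersen graph.\<close>
    have no_sq2: "\<not> (\<exists>t. t \<noteq> vtx a 0 False \<and> (vtx a 1 False, t) \<in> parcs total_graph
        \<and> (vtx a 0 True, t) \<in> parcs total_graph)" for a
      using n_ge nbhd_total_graph[of a 1 False] nbhd_total_graph[of a 0 True]
      by (auto simp: nbhd_def set_eq_iff vtx_eq_iff turn_def)
    \<comment> \<open>A base arc that changed \<open>r\<close> would fix \<open>s\<close>, and would
      then span a square with its predecessor, which fixes \<open>r\<close>.\<close>
    have step: "r (vtx (int a) 0 False) = r (vtx (int a + 1) 0 False)" for a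
    proof (induction a)
      case (Suc a)
      then show ?case
        using no_sq1[of "int a + 1"] arc[OF parcs_total_graph(1)[of "int a + 1" 0 False]]
          sq[of "vtx (int a + 1) 0 False" "vtx (int a) 0 False" "vtx (int a + 2) 0 False"]
          parcs_total_graph(1)[of "int a + 1" 0 False] parcs_total_graph(2)[of "int a + 1" 0 False]
        by (auto simp: add.commute)
    qed (use start in simp)
    have outer: "r (vtx (int a) 0 False) = r (vtx 0 0 False)" for a
      by (induction a) (use step in \<open>auto simp: add.commute\<close>)
    have spoke: "r (vtx (int a) 0 True) = r (vtx (int a) 0 False)" for a
    proof -
      have "vtx (int a) 1 False = vtx (int (a + nat n)) 0 False"
        using vtx_turn[of "int a" 1 0 False] n_ge by simp
      then have "r (vtx (int a) 0 False) = r (vtx (int a) 1 False)" by (simp only: outer)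
      then show ?thesis
        using no_sq2[of "int a"] arc[OF parcs_total_graph(5)[of "int a" 0 False]]
          sq[of "vtx (int a) 0 False" "vtx (int a) 1 False" "vtx (int a) 0 True"]
          parcs_total_graph(3)[of "int a" 0 False] parcs_total_graph(5)[of "int a" 0 False]
        by (auto simp: turn_def)
    qed
    have "r v = r (vtx 0 0 False)" if v: "v \<in> pverts total_graph" for v
    proof -
      obtain a b where "v = vtx (int a) 0 b" using v by (rule pverts_total_graph_cases)
      then show ?thesis using outer[of a] spoke[of a] by (cases b) simp_all
    qed
    then show ?thesis using uv by metis
  qed
  have "p (vtx 0 0 False) = p (vtx 1 0 False) \<or> q (vtx 0 0 False) = q (vtx 1 0 False)"
    using arc[OF parcs_total_graph(1)[of 0 0 False]] by simp
  then show False
  proof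
    assume start: "p (vtx 0 0 False) = p (vtx 1 0 False)"
    have "p u = p v" if "u \<in> pverts total_graph" "v \<in> pverts total_graph" for u v
      by (rule const[of p q, OF arc square start that])
    then show False using nonconst(1) by blast
  next
    assume start: "q (vtx 0 0 False) = q (vtx 1 0 False)"
    have "q u = q v" if "u \<in> pverts total_graph" "v \<in> pverts total_graph" for u v
      by (rule const[of q p, OF _ swapped_square start that]) (use arc in blast)
    then show False using nonconst(2) by blast
  qed
qed

end

theorem theorem1p2:
  shows "\<exists>G :: nat \<Rightarrow> nat pair_pre_digraph.
    (\<forall>i j. i \<noteq> j \<longrightarrow> \<not> digraph_iso (with_proj (G i)) (with_proj (G j))) \<and>
    (\<forall>i. pair_graph (G i) \<and>
         Digraph_Component.connected (with_proj (G i)) \<and>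
         regular 5 (G i) \<and>
         ricci_flat (G i) \<and>
         (\<forall>R :: nat pair_pre_digraph. is_RF72 R \<longrightarrow>
            \<not> digraph_iso (with_proj (G i)) (with_proj R)) \<and>
         \<not> cartesian_product_type (G i))"
\<comment> \<open>Different base lengths give different numbers of vertices, which separates the
  isomorphism classes.\<close>
proof (intro exI[of _ "\<lambda>i. petersen_bundle.total_graph (int i + 7)"] conjI allI impI)
  have pb: "petersen_bundle (int i + 7)" for i by unfold_locales simp
  note card = petersen_bundle.card_pverts_total_graph[OF pb]
  show "\<not> digraph_iso (with_proj (petersen_bundle.total_graph (int i + 7))) (with_proj (petersen_bundle.total_graph (int j + 7)))"
    if "i \<noteq> j" for i j :: nat
    using card_pverts_digraph_iso[of "petersen_bundle.total_graph (int i + 7)" "petersen_bundle.total_graph (int j + 7)"] that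
    by (auto simp: card nat_add_distrib)
  fix i :: nat
  interpret petersen_bundle "int i + 7" by (rule pb)
  show "pair_graph total_graph" ..
  show "Digraph_Component.connected (with_proj total_graph)" by (rule connected_total_graph)
  show "regular 5 total_graph" by (rule regular_total_graph)
  show "ricci_flat total_graph" by (rule ricci_flat_total_graph)
  show "\<not> cartesian_product_type total_graph" by (rule not_cartesian_product_type_total_graph)
  fix R :: "nat pair_pre_digraph"
  assume "is_RF72 R"
  then have "card (pverts R) = 72" by (simp add: is_RF72_def)
  moreover have "10 * m \<noteq> 72" for m :: nat by presburger
  ultimately show "\<not> digraph_iso (with_proj total_graph) (with_proj R)"
    using card_pverts_digraph_iso[of total_graph R] by (auto simp: card_pverts_total_graph)
qed

end
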